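(* The series \[ \sum_{n=1}^{\infty} \frac{(-1)^n |\sin n|}{n} \] converges. *)

theory Defs
  imports "HOL-Analysis.Analysis"
begin

end

theory Submission
  imports Defs
begin

text \<open>
  By Abel summation it suffices that the partial sums \<open>S N\<close> of \<open>(-1) ^ n * \<bar>sin n\<bar>\<close> satisfy
  \<open>\<bar>S N\<bar> \<le> C * N / (ln N) powr (4 / 3)\<close> up to a term of order \<open>sqrt N\<close>, since
  \<open>1 / (n * (ln n) powr (4 / 3))\<close> is summable
  (\<open>summable_over_index_from_partial_sums\<close>, \<open>summable_inverse_mult_ln_powr\<close>).

  To bound \<open>S N\<close>, choose by Dirichlet a reduced fraction \<open>p / q\<close> with \<open>\<bar>q * pi - p\<bar> < 1 / Q\<close> and
  \<open>q \<le> Q\<close>, where \<open>Q\<close> is about \<open>sqrt N\<close>, and cut the sum into blocks. Shifting \<open>n\<close> by \<open>p\<close> almost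
  preserves \<open>\<bar>sin n\<bar>\<close>. If \<open>p\<close> is odd, the shift reverses the sign and blocks of length \<open>2 * p\<close> nearly
  cancel (\<open>odd_block\<close>). If \<open>p\<close> is even, the angles in a block of length \<open>p\<close> are, up to order and
  modulo \<open>pi\<close>, nearly equally spaced by \<open>pi / p\<close>, with signs that alternate in this order. Such a sum is \<open>O(1 / p)\<close>
  (\<open>alternating_sin_full_period\<close>, \<open>even_block\<close>). Either way
  \<open>\<bar>S N\<bar> \<le> 4 * N / p\<^sup>2 + O(sqrt N)\<close>.

  The first term is harmless only if \<open>p\<close> grows with \<open>N\<close> at a definite rate, that is, if \<open>pi\<close> is not
  too well approximable. Niven's irrationality proof, made quantitative, is enough. At a rational
  point \<open>x = k / m\<close> near \<open>pi / 2\<close> it provides small integer combinations of \<open>sin x\<close> and \<open>cos x\<close>, which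
  forces \<open>\<bar>cos x\<bar> \<ge> exp (- C * m * ln m)\<close> (\<open>cos_rational_lower_bound\<close>). Hence \<open>ln Q\<close> is at most of
  order \<open>p powr (3 / 2)\<close> (\<open>pi_approximation_quality\<close>), so that \<open>p\<^sup>2\<close> is at least of order
  \<open>(ln N) powr (4 / 3)\<close>.
\<close>

section \<open>A lower bound for the cosine at rational points\<close>

text \<open>
  These are Niven's integrals \<open>(1 / n!) \<integral> (x\<^sup>2 - t\<^sup>2)\<^sup>n cos t dt\<close> over \<open>[-x, x]\<close>. The recurrence
  that integration by parts gives them serves as the definition, because it shows directly that
  they are combinations of \<open>sin x\<close> and \<open>cos x\<close> with coefficients in \<open>\<int>[x]\<close>; their smallness follows
  from the derivative rule below without any integration.
\<close>

fun niven_form :: "nat \<Rightarrow> real \<Rightarrow> real" where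
  "niven_form 0 x = 2 * sin x"
| "niven_form (Suc 0) x = 4 * sin x - 4 * x * cos x"
| "niven_form (Suc (Suc n)) x =
     (4 * real n + 6) * niven_form (Suc n) x - 4 * x\<^sup>2 * niven_form n x"

text \<open>
  This is differentiation under the integral sign; from the recurrence it comes out by induction,
  both sides obeying the same three-term relation.
\<close>

lemma niven_form_deriv:
  "(niven_form (Suc n) has_real_derivative 2 * x * niven_form n x) (at x)"
proof (induction n rule: less_induct)
  case (less n)
  consider "n = 0" | "n = 1" | j where "n = Suc (Suc j)"
    by (metis One_nat_def not0_implies_Suc)
  then show ?case
  proof cases
    case 1
    have "((\<lambda>x. 4 * sin x - 4 * x * cos x) has_real_derivative 2 * x * (2 * sin x)) (at x)"
      by (auto intro!: derivative_eq_intros)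
    then show ?thesis
      using 1 by (simp add: fun_eq_iff[symmetric])
  next
    case 2
    have "((\<lambda>x. 6 * (4 * sin x - 4 * x * cos x) - 4 * x\<^sup>2 * (2 * sin x))
        has_real_derivative 2 * x * (4 * sin x - 4 * x * cos x)) (at x)"
      by (auto intro!: derivative_eq_intros simp: algebra_simps power2_eq_square)
    then show ?thesis
      using 2 by simp
  next
    case 3
    have d1: "(niven_form (Suc n) has_real_derivative
        (4 * real n + 2) * (2 * x * niven_form (Suc j) x)
        - (8 * x * niven_form (Suc j) x + 4 * x\<^sup>2 * (2 * x * niven_form j x))) (at x)"
      unfolding 3 niven_form.simps(3)[of "Suc j"]
      by (rule derivative_eq_intros less.IH[of "Suc j"] less.IH[of j] refl | simp add: 3)+
    show ?thesis
      by (rule DERIV_cong[OF d1]) (simp add: 3 algebra_simps power2_eq_square)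
  qed
qed

lemma niven_form_0: "niven_form n 0 = 0"
  by (induction n "0::real" rule: niven_form.induct) auto

text \<open>
  The forms vanish at 0, so integrating the bound for \<open>n\<close> against \<open>2 * x\<close> gives the bound for
  \<open>n + 1\<close>: the factorial arises from the factors \<open>2 / (2 * n + 3) \<le> 1 / (n + 1)\<close>.
\<close>

lemma niven_form_bound:
  assumes "x \<ge> 0"
  shows "\<bar>niven_form n x\<bar> \<le> 2 * x ^ (2 * n + 1) / fact n"
  using assms
proof (induction n arbitrary: x)
  case 0
  then show ?case
    using abs_sin_x_le_abs_x[of x] by (simp add: abs_mult)
next
  case (Suc n)
  define C where "C = (2 :: real) / fact (Suc n)"
  \<comment> \<open>Both signs \<open>s\<close> are treated at once: the bound minus \<open>\<plusminus>\<close> the form is nondecreasing from 0.\<close>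
  have step: "C * t ^ (2 * n + 3) + s * niven_form (Suc n) t \<ge> 0"
    if s: "s = 1 \<or> s = -1" and t: "t \<ge> 0" for s t
  proof -
    let ?g = "\<lambda>t. C * t ^ (2 * n + 3) + s * niven_form (Suc n) t"
    have "?g 0 \<le> ?g t"
    proof (rule DERIV_nonneg_imp_nondecreasing[OF t])
      fix u :: real
      assume u: "0 \<le> u" "u \<le> t"
      have d: "(?g has_real_derivative
          C * (real (2 * n + 3) * u ^ (2 * n + 2)) + s * (2 * u * niven_form n u)) (at u)"
        by (rule derivative_eq_intros niven_form_deriv refl | simp)+
      have "\<bar>s * (2 * u * niven_form n u)\<bar> \<le> 2 * u * (2 * u ^ (2 * n + 1) / fact n)"
      proof -
        have "\<bar>s * (2 * u * niven_form n u)\<bar> = 2 * u * \<bar>niven_form n u\<bar>"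
          using s u by (auto simp: abs_mult)
        then show ?thesis
          using mult_left_mono[OF Suc.IH[OF u(1)], of "2 * u"] u by simp
      qed
      also have "\<dots> = C * (real (2 * n + 2) * u ^ (2 * n + 2))"
      proof -
        have "C * real (2 * n + 2) = 4 * (1 + real n) / (fact n * (1 + real n))"
          by (simp add: C_def)
        also have "\<dots> = 4 / fact n"
          by (rule nonzero_mult_divide_mult_cancel_right) linarith
        finally show ?thesis
          by (simp add: mult.assoc[symmetric])
      qed
      also have "\<dots> \<le> C * (real (2 * n + 3) * u ^ (2 * n + 2))"
        using u by (intro mult_left_mono mult_right_mono) (auto simp: C_def)
      finally have "C * (real (2 * n + 3) * u ^ (2 * n + 2)) + s * (2 * u * niven_form n u) \<ge> 0"
        by linarith
      with d show "\<exists>y. (?g has_real_derivative y) (at u) \<and> y \<ge> 0"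
        by blast
    qed
    then show ?thesis
      by (simp add: niven_form_0 power_0_left)
  qed
  from step[of 1 x] step[of "-1" x] Suc.prems show ?case
    by (simp add: C_def numeral_3_eq_3)
qed

text \<open>
  The recurrence of \<^const>\<open>niven_form\<close> at \<open>x = k / m\<close> after multiplication of the \<open>n\<close>-th form by
  \<open>m ^ n\<close>; the starting values \<open>u\<close>, \<open>v\<close> select the coefficient of the sine or of the cosine.
\<close>

fun niven_rec :: "int \<Rightarrow> int \<Rightarrow> int \<Rightarrow> int \<Rightarrow> nat \<Rightarrow> int" where
  "niven_rec k m u v 0 = u"
| "niven_rec k m u v (Suc 0) = v"
| "niven_rec k m u v (Suc (Suc n)) =
     (4 * int n + 6) * m * niven_rec k m u v (Suc n) - 4 * k\<^sup>2 * niven_rec k m u v n"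

lemma niven_rec_form:
  assumes "m \<noteq> 0"
  shows "of_int m ^ n * niven_form n (of_int k / of_int m)
    = of_int (niven_rec k m 2 (4 * m) n) * sin (of_int k / of_int m)
      + of_int (niven_rec k m 0 (- 4 * k) n) * cos (of_int k / of_int m)"
proof (induction n rule: induct_nat_012)
  case 0
  then show ?case by simp
next
  case 1
  then show ?case using assms by (simp add: field_simps)
next
  case (ge2 n)
  let ?x = "of_int k / of_int m :: real"
  have "of_int m ^ Suc (Suc n) * niven_form (Suc (Suc n)) ?x
    = (4 * real n + 6) * of_int m * (of_int m ^ Suc n * niven_form (Suc n) ?x)
      - 4 * (of_int k)\<^sup>2 * (of_int m ^ n * niven_form n ?x)"
    using assms by (simp add: field_simps power2_eq_square)
  also have "\<dots> = of_int (niven_rec k m 2 (4 * m) (Suc (Suc n))) * sin ?x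
      + of_int (niven_rec k m 0 (- 4 * k) (Suc (Suc n))) * cos ?x"
    unfolding ge2 niven_rec.simps(3) by (simp add: algebra_simps)
  finally show ?case .
qed

text \<open>
  The Casoratian of two solutions. Its purpose is nonvanishing: for sine and cosine it is
  nonzero unless \<open>k = 0\<close>, so two consecutive sine coefficients cannot both be zero.
\<close>

lemma niven_rec_det:
  "niven_rec k m u v n * niven_rec k m u' v' (Suc n) - niven_rec k m u v (Suc n) * niven_rec k m u' v' n
    = (4 * k\<^sup>2) ^ n * (u * v' - v * u')"
proof (induction n)
  case 0
  then show ?case by simp
next
  case (Suc n)
  have "niven_rec k m u v (Suc n) * niven_rec k m u' v' (Suc (Suc n))
      - niven_rec k m u v (Suc (Suc n)) * niven_rec k m u' v' (Suc n)
    = 4 * k\<^sup>2 * (niven_rec k m u v n * niven_rec k m u' v' (Suc n)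
      - niven_rec k m u v (Suc n) * niven_rec k m u' v' n)"
    by (simp add: algebra_simps)
  then show ?case
    using Suc by simp
qed

text \<open>
  The constant \<open>M\<close> satisfies \<open>(4 * n + 6) * m * M + 4 * k\<^sup>2 \<le> M\<^sup>2\<close> for every \<open>n\<close> that occurs, so one
  step of the recurrence costs at most a factor \<open>M\<close>.
\<close>

lemma niven_rec_bound:
  assumes "m > 0" "0 \<le> k" "k \<le> 2 * m" "n \<le> N" "M = (4 * int N + 6) * m"
  shows "\<bar>niven_rec k m 0 (- 4 * k) n\<bar> \<le> M ^ n"
  using assms(4)
proof (induction n rule: induct_nat_012)
  case 0
  then show ?case by simp
next
  case 1
  have "8 * m \<le> M"
    unfolding assms(5) using 1 assms(1) by (intro mult_right_mono) auto
  with assms(2,3) show ?case by simp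
next
  case (ge2 n)
  let ?b = "niven_rec k m 0 (- 4 * k)"
  have M: "4 * m \<le> M" "(4 * int n + 10) * m \<le> M"
    unfolding assms(5) using assms(1) ge2.prems by (auto intro!: mult_right_mono)
  have M0: "M \<ge> 0" using M assms by simp
  have k2: "4 * k\<^sup>2 \<le> 4 * m * M"
  proof -
    have "k * k \<le> (2 * m) * (2 * m)"
      using assms by (intro mult_mono) auto
    also have "4 * \<dots> \<le> 4 * (m * M)"
      using M assms by (auto intro!: mult_mono)
    finally show ?thesis
      by (simp add: power2_eq_square)
  qed
  have "\<bar>?b (Suc (Suc n))\<bar> \<le> (4 * int n + 6) * m * \<bar>?b (Suc n)\<bar> + 4 * k\<^sup>2 * \<bar>?b n\<bar>"
    unfolding niven_rec.simps(3) using assms(1)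
    by (intro order.trans[OF abs_triangle_ineq4]) (simp add: abs_mult)
  also have "\<dots> \<le> (4 * int n + 6) * m * M ^ Suc n + (4 * m * M) * M ^ n"
    using ge2 assms(1) M0 by (intro add_mono mult_mono[OF k2] mult_left_mono) auto
  also have "\<dots> = ((4 * int n + 10) * m) * M ^ Suc n"
    by (simp add: algebra_simps)
  also have "\<dots> \<le> M * M ^ Suc n"
    using M M0 by (intro mult_right_mono) auto
  finally show ?case by simp
qed

lemma power_over_fact_le_exp:
  assumes "(x :: real) \<ge> 0"
  shows "x ^ n / fact n \<le> exp x"
proof -
  have "(\<Sum>i\<in>{n}. inverse (fact i) * x ^ i) \<le> (\<Sum>i. inverse (fact i) * x ^ i)"
    using assms by (intro sum_le_suminf summable_exp) auto
  then show ?thesis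
    by (simp add: exp_def field_simps)
qed

text \<open>
  Since \<open>(8 * m) ^ n / n! \<le> exp (8 * m) \<le> 3 ^ (8 * m)\<close>, halving the base to \<open>4 * m\<close> gains
  \<open>2 ^ n \<ge> 8 ^ (8 * m)\<close>, which wins as soon as \<open>n \<ge> 24 * m\<close>.
\<close>

lemma power_over_fact_small:
  assumes "m \<ge> 1" "n \<ge> 24 * m"
  shows "(4 * real m) ^ n / fact n \<le> 1 / 16"
proof -
  have "(4 * real m) ^ n / fact n = ((8 * real m) ^ n / fact n) / 2 ^ n"
  proof -
    have "8 * real m = 2 * (4 * real m)"
      by simp
    then have eq: "(8 * real m) ^ n = 2 ^ n * (4 * real m) ^ n"
      by (metis power_mult_distrib)
    show ?thesis
      unfolding eq by simp
  qed
  also have "\<dots> \<le> exp (8 * real m) / 2 ^ (24 * m)"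
    using assms by (intro frac_le power_over_fact_le_exp power_increasing) auto
  also have "exp (8 * real m) = exp 1 ^ (8 * m)"
    by (simp flip: exp_of_nat_mult)
  also have "exp (1::real) ^ (8 * m) / 2 ^ (24 * m) \<le> 3 ^ (8 * m) / 2 ^ (24 * m)"
    using exp_le by (intro divide_right_mono power_mono) auto
  also have "\<dots> = (3 / 8) ^ (8 * m)"
    by (simp add: power_divide power_mult)
  also have "\<dots> \<le> (3 / 8) ^ 8"
    using assms by (intro power_decreasing) auto
  also have "\<dots> \<le> (1 / 16 :: real)"
    by (simp add: power_divide)
  finally show ?thesis .
qed

text \<open>
  With \<open>x = k / m\<close> and \<open>n\<close> about \<open>24 * m\<close>, the number \<open>m ^ n\<close> times the \<open>n\<close>-th form is tiny, but it
  equals \<open>a * sin x + b * cos x\<close> with integers \<open>a \<noteq> 0\<close> and \<open>b\<close>. If \<open>cos x\<close> is small then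
  \<open>\<bar>a * sin x\<bar> \<ge> 1/2\<close>, so \<open>b * cos x\<close> has to compensate it, and \<open>b\<close> is not too large.
\<close>

lemma cos_rational_lower_bound:
  fixes k m :: nat
  assumes m: "m \<ge> 1" and k: "k \<ge> 1" "k \<le> 2 * m"
  shows "1 \<le> \<bar>cos (real k / real m)\<bar> * (4 * (106 * (real m)\<^sup>2) ^ (25 * m))"
proof -
  define x where "x = real k / real m"
  have x: "0 \<le> x" "x \<le> 2"
    using assms by (auto simp: x_def field_simps)
  \<comment> \<open>This majorizes \<open>(4 * N + 6) * m\<close> for \<open>N = 24 * m + 1\<close>, the largest index used.\<close>
  define M where "M = 106 * (real m)\<^sup>2"
  have M1: "M \<ge> 1"
    using m unfolding M_def by (smt (verit) one_le_power of_nat_1 of_nat_mono)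
  show ?thesis
  proof (cases "\<bar>cos x\<bar> \<ge> 1 / 2")
    case True
    have "1 \<le> M ^ (25 * m)"
      using M1 by (rule one_le_power)
    then have "(1 / 2) * (4 * 1) \<le> \<bar>cos x\<bar> * (4 * M ^ (25 * m))"
      using True by (intro mult_mono) auto
    then show ?thesis
      unfolding M_def x_def by linarith
  next
    case False
    have sin: "\<bar>sin x\<bar> \<ge> 1 / 2"
    proof (rule ccontr)
      assume "\<not> ?thesis"
      then have "(sin x)\<^sup>2 < (1/2)\<^sup>2" "(cos x)\<^sup>2 < (1/2)\<^sup>2"
        using False by (auto simp: abs_square_less_1 simp flip: abs_less_iff
            intro!: power2_strict_mono)
      then show False
        using sin_cos_squared_add[of x] by (simp add: power2_eq_square)
    qed
    let ?a = "niven_rec (int k) (int m) 2 (4 * int m)"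
    let ?b = "niven_rec (int k) (int m) 0 (- 4 * int k)"
    obtain n where n: "24 * m \<le> n" "n \<le> 24 * m + 1" "?a n \<noteq> 0"
    proof -
      have "?a (24 * m) \<noteq> 0 \<or> ?a (24 * m + 1) \<noteq> 0"
        using niven_rec_det[of "int k" "int m" 2 "4 * int m" "24 * m" 0 "- 4 * int k"] k
        by auto
      then show ?thesis
        using that[of "24 * m"] that[of "24 * m + 1"] by auto
    qed
    have form: "real m ^ n * niven_form n x = of_int (?a n) * sin x + of_int (?b n) * cos x"
      using niven_rec_form[of "int m" n "int k"] m by (simp add: x_def)
    have "real m ^ n * \<bar>niven_form n x\<bar> \<le> real m ^ n * (2 * x ^ (2 * n + 1) / fact n)"
      by (intro mult_left_mono niven_form_bound x) auto
    also have "\<dots> \<le> real m ^ n * (2 * 2 ^ (2 * n + 1) / fact n)"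
      using x by (intro mult_left_mono divide_right_mono power_mono) auto
    also have "\<dots> = 4 * ((4 * real m) ^ n / fact n)"
      by (simp add: power_mult_distrib power_mult)
    also have "\<dots> \<le> 1 / 4"
      using power_over_fact_small[OF m n(1)] by simp
    finally have small: "\<bar>real m ^ n * niven_form n x\<bar> \<le> 1 / 4"
      by (simp add: abs_mult)
    have "1 * (1 / 2) \<le> \<bar>of_int (?a n)\<bar> * \<bar>sin x\<bar>"
      using n(3) sin by (intro mult_mono) (auto simp flip: of_int_abs)
    then have "1 / 4 \<le> \<bar>of_int (?b n) * cos x\<bar>"
      using small unfolding form abs_mult[symmetric] by linarith
    also have "\<dots> = \<bar>of_int (?b n)\<bar> * \<bar>cos x\<bar>"
      by (rule abs_mult)
    also have "\<dots> \<le> M ^ (25 * m) * \<bar>cos x\<bar>"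
    proof (intro mult_right_mono)
      have "\<bar>?b n\<bar> \<le> ((4 * int (24 * m + 1) + 6) * int m) ^ n"
        using m k n by (intro niven_rec_bound[where N = "24 * m + 1"]) auto
      then have "\<bar>real_of_int (?b n)\<bar> \<le> of_int (((4 * int (24 * m + 1) + 6) * int m) ^ n)"
        by (metis of_int_abs of_int_le_iff)
      also have "\<dots> = ((96 * real m + 10) * real m) ^ n"
        by (simp add: algebra_simps)
      also have "\<dots> \<le> M ^ n"
      proof (intro power_mono)
        have "(96 * real m + 10) * real m \<le> (106 * real m) * real m"
          using m by (intro mult_right_mono) auto
        then show "(96 * real m + 10) * real m \<le> M"
          by (simp add: M_def power2_eq_square)
      qed auto
      also have "\<dots> \<le> M ^ (25 * m)"
        using n m M1 by (intro power_increasing) auto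
      finally show "\<bar>real_of_int (?b n)\<bar> \<le> M ^ (25 * m)" .
    qed auto
    finally show ?thesis
      by (simp add: M_def x_def algebra_simps)
  qed
qed

section \<open>Rational approximations of pi\<close>

lemma near_pi_multiple_bounds:
  fixes p q Q :: nat
  assumes "q \<ge> 1" "Q \<ge> 1" "\<bar>real q * pi - real p\<bar> < 1 / real Q"
  shows "2 * q \<le> p" "p \<le> 4 * q"
proof -
  have "1 / real Q \<le> 1"
    using assms(2) by simp
  then have *: "\<bar>real q * pi - real p\<bar> < 1"
    using assms(3) by linarith
  have "real q * 3 \<le> real q * pi"
    using pi_gt3 by (intro mult_left_mono) auto
  then have "real (3 * q) < real (p + 1)"
    using * by simp
  then have "3 * q < p + 1"
    by (simp only: of_nat_less_iff)
  then show "2 * q \<le> p"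
    using assms(1) by linarith
  have "real q * pi \<le> real q * 3.15"
    using pi_approx by (intro mult_left_mono) auto
  then have "real (100 * p) < real (315 * q + 100)"
    using * by simp
  then have "100 * p < 315 * q + 100"
    by (simp only: of_nat_less_iff)
  then show "p \<le> 4 * q"
    using assms(1) by linarith
qed

text \<open>
  At the rational point \<open>p / (2 * q)\<close> near \<open>pi / 2\<close> the cosine is at most \<open>1 / Q\<close>, so the lower bound
  for the cosine limits \<open>Q\<close> to roughly \<open>exp (C * q * ln q)\<close>. The exponent \<open>3 / 2\<close> absorbs the
  logarithm; any exponent below 2 would serve for the series.
\<close>

lemma pi_approximation_quality:
  fixes p q Q :: nat
  assumes q: "q \<ge> 1" and Q: "Q \<ge> 1" and near: "\<bar>real q * pi - real p\<bar> < 1 / real Q"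
  shows "ln (real Q) \<le> 3000 * real p powr (3 / 2)"
proof -
  note b = near_pi_multiple_bounds[OF q Q near]
  define m where "m = 2 * q"
  define M where "M = 106 * (real m)\<^sup>2"
  have m: "m \<ge> 1" "real m \<ge> 1"
    using q by (auto simp: m_def)
  have "\<bar>cos (real p / real m)\<bar> = \<bar>sin (pi / 2 - real p / real m)\<bar>"
    by (simp add: sin_diff)
  also have "\<dots> \<le> \<bar>pi / 2 - real p / real m\<bar>"
    by (rule abs_sin_x_le_abs_x)
  also have "pi / 2 - real p / real m = (real q * pi - real p) / real m"
    using q by (simp add: m_def field_simps)
  also have "\<bar>\<dots>\<bar> = \<bar>real q * pi - real p\<bar> / real m"
    by simp
  also have "\<dots> \<le> \<bar>real q * pi - real p\<bar> / 1"
    using m by (intro divide_left_mono) auto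
  also have "\<dots> \<le> 1 / real Q"
    using near by simp
  finally have cos: "\<bar>cos (real p / real m)\<bar> \<le> 1 / real Q" .
  have "1 \<le> \<bar>cos (real p / real m)\<bar> * (4 * M ^ (25 * m))"
    unfolding M_def using b q by (intro cos_rational_lower_bound) (auto simp: m_def)
  also have "\<dots> \<le> 1 / real Q * (4 * M ^ (25 * m))"
    using cos by (intro mult_right_mono) (auto simp: M_def)
  finally have "real Q \<le> 4 * M ^ (25 * m)"
    using Q by (simp add: field_simps)
  then have "ln (real Q) \<le> ln (4 * M ^ (25 * m))"
    using Q by (subst ln_le_cancel_iff) auto
  also have "\<dots> = ln 4 + real (25 * m) * (ln 106 + 2 * ln (real m))"
    using m by (simp add: M_def ln_mult ln_realpow ring_distribs)
  also have "\<dots> \<le> 3 + real (25 * m) * (105 + 4 * real m powr (1 / 2))"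
    using m ln_powr_bound[of "real m" "1 / 2"] ln_le_minus_one[of 4] ln_le_minus_one[of 106]
    by (intro add_mono mult_left_mono) auto
  also have "\<dots> = 3 + 2625 * real m + 100 * real m powr (3 / 2)"
  proof -
    have "real m powr (3 / 2) = real m powr (1 + 1 / 2)"
      by simp
    also have "\<dots> = real m * real m powr (1 / 2)"
      using m by (subst powr_add) simp
    finally show ?thesis
      by (simp add: algebra_simps)
  qed
  also have "\<dots> \<le> 3000 * real m powr (3 / 2)"
  proof -
    have "real m powr 0 \<le> real m powr (3 / 2)" "real m powr 1 \<le> real m powr (3 / 2)"
      using m by (intro powr_mono; simp)+
    then show ?thesis
      using m by simp
  qed
  also have "\<dots> \<le> 3000 * real p powr (3 / 2)"
    using b by (intro mult_left_mono powr_mono2) (auto simp: m_def)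
  finally show ?thesis .
qed

lemma obtain_pi_fraction:
  assumes "Q \<ge> 1"
  obtains p q :: nat where "coprime p q" "1 \<le> q" "q \<le> Q" "\<bar>real q * pi - real p\<bar> < 1 / real Q"
proof -
  obtain h k where hk: "coprime h k" "0 < k" "k \<le> int Q" "\<bar>of_int k * pi - of_int h\<bar> < 1 / real Q"
    using Dirichlet_approx_coprime[of Q pi] assms by auto
  have "1 / real Q \<le> 1"
    using assms by simp
  moreover have "1 * 3 \<le> real_of_int k * pi"
    using hk(2) pi_gt3 by (intro mult_mono) auto
  ultimately have "real_of_int h > 0"
    using hk(4) by linarith
  then have h: "h = int (nat h)" and k: "k = int (nat k)"
    using hk(2) by simp_all
  show ?thesis
  proof (rule that[of "nat h" "nat k"])
    show "coprime (nat h) (nat k)"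
      using hk(1) h k by (metis coprime_int_iff)
    show "\<bar>real (nat k) * pi - real (nat h)\<bar> < 1 / real Q"
      using hk(4) h k by (metis of_int_of_nat_eq)
  qed (use hk in auto)
qed

section \<open>Block sums of the alternating sequence\<close>

definition alt_sin :: "nat \<Rightarrow> real" where
  "alt_sin n = (-1) ^ n * \<bar>sin (real n)\<bar>"

lemma abs_alt_sin_le_1: "\<bar>alt_sin n\<bar> \<le> 1"
  by (simp add: alt_sin_def abs_mult power_abs)

lemma sum_le_of_block_sums:
  fixes f :: "nat \<Rightarrow> real"
  assumes b: "b > 0" and f: "\<And>n. \<bar>f n\<bar> \<le> 1"
    and block: "\<And>a. \<bar>\<Sum>r<b. f (a + r)\<bar> \<le> e"
  shows "\<bar>\<Sum>n<N. f n\<bar> \<le> real N / real b * e + real b"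
proof (induction N rule: less_induct)
  case (less N)
  have e: "e \<ge> 0"
    using block[of 0] by linarith
  show ?case
  proof (cases "N < b")
    case True
    have "\<bar>\<Sum>n<N. f n\<bar> \<le> (\<Sum>n<N. 1)"
      using f by (intro order.trans[OF sum_abs] sum_mono) auto
    also have "\<dots> \<le> real b"
      using True by simp
    also have "\<dots> \<le> real N / real b * e + real b"
      using e by simp
    finally show ?thesis .
  next
    case False
    define a where "a = N - b"
    have N: "N = a + b"
      using False by (simp add: a_def)
    have "(\<Sum>n<N. f n) = (\<Sum>n<a. f n) + (\<Sum>r<b. f (a + r))"
      unfolding N by (induction b) auto
    moreover have "\<bar>\<Sum>n<a. f n\<bar> \<le> real a / real b * e + real b"
      using b by (intro less.IH) (auto simp: N)
    moreover have "real N / real b * e = real a / real b * e + e"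
      using b by (simp add: N field_simps)
    ultimately show ?thesis
      using block[of a] by linarith
  qed
qed

lemma abs_sin_shift_pi: "\<bar>sin (x + real j * pi)\<bar> = \<bar>sin x\<bar>"
  by (simp add: sin_add abs_mult)

lemma abs_sin_diff_le: "\<bar>\<bar>sin x\<bar> - \<bar>sin y\<bar>\<bar> \<le> \<bar>x - y :: real\<bar>"
proof -
  have "\<bar>sin x - sin y\<bar> = 2 * \<bar>sin ((x - y) / 2)\<bar> * \<bar>cos ((x + y) / 2)\<bar>"
    by (simp add: sin_diff_sin abs_mult)
  also have "\<dots> \<le> 2 * \<bar>(x - y) / 2\<bar> * 1"
    by (intro mult_mono abs_sin_x_le_abs_x) auto
  finally show ?thesis
    by simp
qed

text \<open>
  Passing from \<open>n\<close> to \<open>n + p\<close> flips the sign \<open>(-1) ^ n\<close> and hardly changes \<open>\<bar>sin n\<bar>\<close>, as \<open>p\<close> is within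
  \<open>1 / Q\<close> of a period. The two halves of a block of length \<open>2 * p\<close> therefore almost cancel.
\<close>

lemma odd_block:
  fixes p q Q :: nat
  assumes "odd p" and near: "\<bar>real q * pi - real p\<bar> < 1 / real Q"
  shows "\<bar>\<Sum>r<2 * p. alt_sin (a + r)\<bar> \<le> real p / real Q"
proof -
  have "(\<Sum>r<2 * p. alt_sin (a + r)) = (\<Sum>r<p. alt_sin (a + r)) + (\<Sum>r<p. alt_sin (a + (p + r)))"
  proof -
    have "(\<Sum>r<p + c. alt_sin (a + r)) = (\<Sum>r<p. alt_sin (a + r)) + (\<Sum>r<c. alt_sin (a + (p + r)))" for c
      by (induction c) auto
    then show ?thesis
      by (simp add: mult_2)
  qed
  also have "\<bar>\<dots>\<bar> = \<bar>\<Sum>r<p. alt_sin (a + r) + alt_sin (a + (p + r))\<bar>"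
    by (simp add: sum.distrib)
  also have "\<dots> \<le> (\<Sum>r<p. 1 / real Q)"
  proof (intro order.trans[OF sum_abs] sum_mono)
    fix r
    have "alt_sin (a + r) + alt_sin (a + (p + r))
      = (-1) ^ (a + r) * (\<bar>sin (real (a + r) + real q * pi)\<bar> - \<bar>sin (real (a + (p + r)))\<bar>)"
      unfolding abs_sin_shift_pi using \<open>odd p\<close> by (simp add: alt_sin_def power_add algebra_simps)
    then have "\<bar>alt_sin (a + r) + alt_sin (a + (p + r))\<bar>
      = \<bar>\<bar>sin (real (a + r) + real q * pi)\<bar> - \<bar>sin (real (a + (p + r)))\<bar>\<bar>"
      by (simp add: abs_mult power_abs)
    also have "\<dots> \<le> \<bar>real (a + r) + real q * pi - real (a + (p + r))\<bar>"
      by (rule abs_sin_diff_le)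
    also have "\<dots> \<le> 1 / real Q"
      using near by simp
    finally show "\<bar>alt_sin (a + r) + alt_sin (a + (p + r))\<bar> \<le> 1 / real Q" .
  qed
  finally show ?thesis
    by simp
qed

text \<open>
  For such \<open>t\<close> all arguments lie in \<open>[0, pi]\<close>, the absolute values disappear, and multiplication by
  \<open>2 * cos (pi / (2 * p))\<close> makes the sum telescope to the single term \<open>2 * sin (t - pi / (2 * p))\<close>.
\<close>

lemma alternating_sin_first_period:
  fixes p :: nat
  assumes p: "even p" "p \<ge> 2" and t: "0 \<le> t" "t < pi / real p"
  shows "\<bar>\<Sum>s<p. (-1) ^ s * \<bar>sin (t + real s * pi / real p)\<bar>\<bar> \<le> 4 / real p"
proof -
  define h where "h = pi / (2 * real p)"
  have h: "0 < h" "h \<le> pi / 4"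
    using p by (auto simp: h_def field_simps)
  have tele: "2 * cos h * (\<Sum>s<n. (-1) ^ s * sin (t + real s * pi / real p))
      = sin (t - h) - (-1) ^ n * sin (t - h + real n * pi / real p)" for n
  proof (induction n)
    case 0
    then show ?case by simp
  next
    case (Suc n)
    let ?y = "t + real n * pi / real p"
    have "2 * cos h * sin ?y = sin (?y + h) + sin (?y - h)"
      by (simp add: sin_add sin_diff)
    moreover have "?y + h = t - h + real (Suc n) * pi / real p"
      using p by (simp add: h_def field_simps)
    moreover have "?y - h = t - h + real n * pi / real p"
      by simp
    ultimately have "2 * cos h * sin ?y =
        sin (t - h + real (Suc n) * pi / real p) + sin (t - h + real n * pi / real p)"
      by metis
    then have "2 * cos h * ((-1) ^ n * sin ?y) = (-1) ^ n *
        (sin (t - h + real (Suc n) * pi / real p) + sin (t - h + real n * pi / real p))"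
      by (metis mult.left_commute)
    then show ?case
      using Suc by (simp add: algebra_simps)
  qed
  have pos: "\<bar>sin (t + real s * pi / real p)\<bar> = sin (t + real s * pi / real p)" if "s < p" for s
  proof -
    have "t + real s * pi / real p \<le> pi / real p + real s * pi / real p"
      using t by simp
    also have "\<dots> = real (Suc s) / real p * pi"
      by (simp add: distrib_right add_divide_distrib)
    also have "\<dots> \<le> 1 * pi"
      using that by (intro mult_right_mono) auto
    finally show ?thesis
      using t by (intro abs_of_nonneg sin_ge_zero) auto
  qed
  define F where "F = (\<Sum>s<p. (-1) ^ s * sin (t + real s * pi / real p))"
  have "2 * cos h * F = 2 * sin (t - h)"
    unfolding F_def tele using p by simp
  then have "\<bar>cos h\<bar> * \<bar>F\<bar> = \<bar>sin (t - h)\<bar>"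
    by (simp flip: abs_mult)
  also have "\<dots> \<le> \<bar>t - h\<bar>"
    by (rule abs_sin_x_le_abs_x)
  also have "\<dots> \<le> h"
    using t by (simp add: h_def field_simps abs_le_iff)
  finally have 1: "\<bar>cos h\<bar> * \<bar>F\<bar> \<le> h" .
  have "cos (pi / 3) \<le> cos h"
    using h by (intro cos_monotone_0_pi_le) auto
  then have "1 / 2 * \<bar>F\<bar> \<le> \<bar>cos h\<bar> * \<bar>F\<bar>"
    by (intro mult_right_mono) (auto simp: cos_60)
  with 1 have "\<bar>F\<bar> \<le> pi / real p"
    by (simp add: h_def)
  also have "\<dots> \<le> 4 / real p"
    using pi_less_4 by (intro divide_right_mono) auto
  finally show ?thesis
    using pos by (simp add: F_def)
qed

text \<open>
  Replacing \<open>t\<close> by \<open>t + pi / p\<close> rotates the summands by one place, which only changes the sign of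
  the sum because \<open>p\<close> is even. So \<open>t\<close> may be reduced to \<open>[0, pi / p)\<close>.
\<close>

lemma alternating_sin_full_period:
  fixes p :: nat
  assumes p: "even p" "p \<ge> 2" and t: "t \<ge> 0"
  shows "\<bar>\<Sum>s<p. (-1) ^ s * \<bar>sin (t + real s * pi / real p)\<bar>\<bar> \<le> 4 / real p"
proof -
  define F where "F t = (\<Sum>s<p. (-1) ^ s * \<bar>sin (t + real s * pi / real p)\<bar>)" for t
  have shift: "F (t + pi / real p) = - F t" for t
  proof -
    define g where "g s = (-1) ^ s * \<bar>sin (t + real s * pi / real p)\<bar>" for s :: nat
    have arg: "t + pi / real p + real s * pi / real p = t + real (Suc s) * pi / real p" for s
      by (simp add: distrib_right add_divide_distrib)
    have "F (t + pi / real p) = - (\<Sum>s<p. g (Suc s))"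
      unfolding F_def g_def arg sum_negf[symmetric] by (intro sum.cong) simp_all
    moreover have "(\<Sum>s<p. g (Suc s)) = (\<Sum>s<p. g s) + g p - g 0"
      using sum.lessThan_Suc_shift[of g p] by simp
    moreover have "g p = g 0"
      using p by (simp add: g_def)
    ultimately show ?thesis
      by (simp add: F_def g_def)
  qed
  define d where "d = pi / real p"
  have d: "d > 0"
    using p by (simp add: d_def)
  have shifts: "\<bar>F (u + real j * d)\<bar> = \<bar>F u\<bar>" for u j
  proof (induction j)
    case (Suc j)
    have "u + real (Suc j) * d = (u + real j * d) + pi / real p"
      by (simp add: distrib_right flip: d_def)
    then show ?case
      using Suc by (simp only: shift abs_minus_cancel)
  qed simp
  define j where "j = nat \<lfloor>t / d\<rfloor>"
  define u where "u = t - real j * d"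
  have j: "real j = of_int \<lfloor>t / d\<rfloor>"
    using t d by (simp add: j_def)
  have "real j \<le> t / d" "t / d < real j + 1"
    unfolding j by linarith+
  then have "0 \<le> u" "u < d"
    using d by (simp_all add: u_def pos_le_divide_eq pos_divide_less_eq distrib_right)
  then have "\<bar>F u\<bar> \<le> 4 / real p"
    unfolding F_def d_def by (rule alternating_sin_first_period[OF p])
  then show ?thesis
    using shifts[of u j] by (simp add: u_def F_def)
qed

lemma sum_reindex_mult_mod:
  fixes h :: "nat \<Rightarrow> 'a :: comm_monoid_add"
  assumes "coprime p q" "p > 0" and periodic: "\<And>j. h (j mod p) = h j"
  shows "(\<Sum>r<p. h (r * q)) = (\<Sum>s<p. h s)"
proof -
  have inj: "inj_on (\<lambda>r. r * q mod p) {..<p}"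
  proof (rule linorder_inj_onI')
    fix i j assume ij: "i \<in> {..<p}" "j \<in> {..<p}" "i < j"
    show "i * q mod p \<noteq> j * q mod p"
    proof
      assume "i * q mod p = j * q mod p"
      then have "p dvd j * q - i * q"
        using ij by (metis mod_eq_dvd_iff_nat less_imp_le mult_le_mono1)
      then have "p dvd (j - i) * q"
        by (simp add: diff_mult_distrib)
      then have "p dvd j - i"
        using \<open>coprime p q\<close> by (simp add: coprime_dvd_mult_left_iff)
      then show False
        using ij by (auto dest: dvd_imp_le)
    qed
  qed
  have image: "(\<lambda>r. r * q mod p) ` {..<p} = {..<p}"
    using inj \<open>p > 0\<close> by (intro endo_inj_surj) auto
  have "(\<Sum>s<p. h s) = (\<Sum>r<p. h (r * q mod p))"
    using sum.reindex[OF inj, of h] by (simp add: image)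
  then show ?thesis
    by (simp add: periodic)
qed

text \<open>
  Replacing \<open>r\<close> by \<open>r * q * pi / p\<close> inside the sine moves each argument by less than \<open>1 / Q\<close>. Since \<open>q\<close>
  is odd and coprime to the even \<open>p\<close>, the signs \<open>(-1) ^ r\<close> and \<open>(-1) ^ (r * q)\<close> agree and \<open>r * q\<close> runs through
  all residues modulo \<open>p\<close>, so the modified block is an alternating sum over equally spaced angles.
\<close>

lemma even_block:
  fixes p q Q :: nat
  assumes p: "even p" "p \<ge> 2" and "coprime p q" and near: "\<bar>real q * pi - real p\<bar> < 1 / real Q"
  shows "\<bar>\<Sum>r<p. alt_sin (a + r)\<bar> \<le> 4 / real p + real p / real Q"
proof -
  have "odd q"
    using p \<open>coprime p q\<close> by (metis coprime_common_divisor odd_one)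
  define h where "h j = (-1) ^ j * \<bar>sin (real a + real j * pi / real p)\<bar>" for j :: nat
  have periodic: "h (j mod p) = h j" for j
  proof -
    have "h (i + p * c) = h i" for i c
    proof -
      have "real a + real (i + p * c) * pi / real p = (real a + real i * pi / real p) + real c * pi"
        using p by (simp add: field_simps)
      then show ?thesis
        using p unfolding h_def by (simp only: abs_sin_shift_pi) (simp add: power_add power_mult)
    qed
    from this[of "j mod p" "j div p"] show ?thesis
      by simp
  qed
  define g where "g r = (-1) ^ a * h (r * q)" for r
  have "(\<Sum>r<p. g r) = (-1) ^ a * (\<Sum>s<p. h s)"
    using sum_reindex_mult_mod[of p q h, OF \<open>coprime p q\<close> _ periodic] p by (simp add: g_def flip: sum_distrib_left)
  then have "\<bar>\<Sum>r<p. g r\<bar> = \<bar>\<Sum>s<p. h s\<bar>"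
    by (simp add: abs_mult power_abs)
  also have "\<dots> \<le> 4 / real p"
    unfolding h_def using alternating_sin_full_period[OF p, of "real a"] by simp
  finally have main: "\<bar>\<Sum>r<p. g r\<bar> \<le> 4 / real p" .
  have "\<bar>\<Sum>r<p. alt_sin (a + r) - g r\<bar> \<le> (\<Sum>r<p. 1 / real Q)"
  proof (intro order.trans[OF sum_abs] sum_mono)
    fix r assume "r \<in> {..<p}"
    have sign: "(-1 :: real) ^ (r * q) = (-1) ^ r"
      using \<open>odd q\<close> by (simp add: mult.commute[of r] power_mult)
    have "alt_sin (a + r) - g r = (-1) ^ (a + r) *
        (\<bar>sin (real (a + r))\<bar> - \<bar>sin (real a + real (r * q) * pi / real p)\<bar>)"
      unfolding alt_sin_def g_def h_def sign by (simp add: power_add right_diff_distrib)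
    then have "\<bar>alt_sin (a + r) - g r\<bar> =
        \<bar>\<bar>sin (real (a + r))\<bar> - \<bar>sin (real a + real (r * q) * pi / real p)\<bar>\<bar>"
      by (simp add: abs_mult power_abs)
    also have "\<dots> \<le> \<bar>real (a + r) - (real a + real (r * q) * pi / real p)\<bar>"
      by (rule abs_sin_diff_le)
    also have "real (a + r) - (real a + real (r * q) * pi / real p)
        = - (real r / real p * (real q * pi - real p))"
      using p by (simp add: field_simps)
    also have "\<bar>\<dots>\<bar> = real r / real p * \<bar>real q * pi - real p\<bar>"
      by (simp add: abs_mult)
    also have "\<dots> \<le> 1 * (1 / real Q)"
      using near \<open>r \<in> {..<p}\<close> by (intro mult_mono) auto
    finally show "\<bar>alt_sin (a + r) - g r\<bar> \<le> 1 / real Q"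
      by simp
  qed
  then have "\<bar>(\<Sum>r<p. alt_sin (a + r)) - (\<Sum>r<p. g r)\<bar> \<le> real p / real Q"
    by (simp add: sum_subtractf)
  with main show ?thesis
    by linarith
qed

section \<open>Partial sums and convergence\<close>

lemma alt_sin_partial_sum_via_fraction:
  fixes p q Q :: nat
  assumes "coprime p q" "p \<ge> 2" "\<bar>real q * pi - real p\<bar> < 1 / real Q"
  shows "\<bar>\<Sum>n<N. alt_sin n\<bar> \<le> 4 * real N / (real p)\<^sup>2 + real N / real Q + 2 * real p"
proof (cases "even p")
  case True
  have "\<bar>\<Sum>n<N. alt_sin n\<bar> \<le> real N / real p * (4 / real p + real p / real Q) + real p"
    using assms True by (intro sum_le_of_block_sums abs_alt_sin_le_1 even_block) auto
  also have "real N / real p * (4 / real p + real p / real Q)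
      = 4 * real N / (real p)\<^sup>2 + real N / real Q"
    using assms by (simp add: ring_distribs power2_eq_square)
  finally show ?thesis
    by simp
next
  case False
  have "\<bar>\<Sum>n<N. alt_sin n\<bar> \<le> real N / real (2 * p) * (real p / real Q) + real (2 * p)"
    using assms False by (intro sum_le_of_block_sums abs_alt_sin_le_1 odd_block) auto
  also have "real N / real (2 * p) * (real p / real Q) = real N / real Q / 2"
    using assms by simp
  also have "\<dots> \<le> 4 * real N / (real p)\<^sup>2 + real N / real Q"
  proof -
    have half: "x / 2 \<le> y + x" if "x \<ge> 0" "y \<ge> 0" for x y :: real
      using that by linarith
    show ?thesis
      by (rule half) simp_all
  qed
  finally show ?thesis
    by simp
qed

text \<open>
  Take a fraction \<open>p / q\<close> from Dirichlet's theorem with \<open>Q\<close> about \<open>sqrt N\<close>. The error terms \<open>N / Q\<close>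
  and \<open>p\<close> are then of order \<open>sqrt N\<close>, and \<open>p\<close> cannot be small: \<open>p\<^sup>2\<close> is at least of order
  \<open>(ln N) powr (4 / 3)\<close> by the bound for approximations of \<open>pi\<close>.
\<close>

lemma alt_sin_partial_sum_bound:
  assumes N: "N \<ge> 1"
  shows "\<bar>\<Sum>n<N. alt_sin n\<bar>
    \<le> 4 * 7000 powr (4 / 3) * (real N * ln (2 * real N) powr (- 4 / 3)) + 10 * real N powr (1 / 2)"
proof -
  define Q where "Q = nat \<lfloor>sqrt (real N)\<rfloor>"
  have Q: "Q \<ge> 1" "real Q \<le> sqrt (real N)" "sqrt (real N) \<le> 2 * real Q"
  proof -
    have s: "sqrt (real N) \<ge> 1"
      using N by simp
    then show 1: "Q \<ge> 1"
      by (simp add: Q_def le_nat_iff)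
    have Qi: "real Q = of_int \<lfloor>sqrt (real N)\<rfloor>"
      using s by (simp add: Q_def)
    then show "real Q \<le> sqrt (real N)"
      by simp
    have "sqrt (real N) \<le> real Q + 1"
      unfolding Qi by linarith
    then show "sqrt (real N) \<le> 2 * real Q"
      using 1 by linarith
  qed
  obtain p q where pq: "coprime p q" "1 \<le> q" "q \<le> Q" "\<bar>real q * pi - real p\<bar> < 1 / real Q"
    using obtain_pi_fraction[OF Q(1)] .
  have p: "2 \<le> p" "p \<le> 4 * Q"
    using near_pi_multiple_bounds[OF pq(2) Q(1) pq(4)] pq(2,3) by linarith+
  have sq: "real N = sqrt (real N) * sqrt (real N)"
    by simp
  have NQ: "real N / real Q \<le> 2 * sqrt (real N)"
  proof -
    have "real N \<le> sqrt (real N) * (2 * real Q)"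
      by (subst sq, intro mult_left_mono Q) auto
    then show ?thesis
      using Q(1) by (simp add: field_simps)
  qed
  have lnN: "ln (2 * real N) \<le> 7000 * real p powr (3 / 2)"
  proof -
    have "real N \<le> (2 * real Q) * (2 * real Q)"
      by (subst sq, intro mult_mono Q) auto
    then have "ln (2 * real N) \<le> ln (8 * (real Q)\<^sup>2)"
      using N Q(1) by (subst ln_le_cancel_iff) (auto simp: power2_eq_square)
    also have "\<dots> = ln 8 + 2 * ln (real Q)"
      using Q(1) by (simp add: ln_mult ln_realpow)
    also have "\<dots> \<le> 7 + 2 * (3000 * real p powr (3 / 2))"
      using ln_le_minus_one[of 8] pi_approximation_quality[OF pq(2) Q(1) pq(4)] by simp
    also have "\<dots> \<le> 7000 * real p powr (3 / 2)"
      using powr_mono[of 0 "3 / 2" "real p"] p by simp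
    finally show ?thesis .
  qed
  have pos: "ln (2 * real N) > 0"
    using N by simp
  have "ln (2 * real N) powr (4 / 3) \<le> (7000 * real p powr (3 / 2)) powr (4 / 3)"
    using lnN pos by (intro powr_mono2) auto
  also have "\<dots> = 7000 powr (4 / 3) * (real p)\<^sup>2"
    using p by (simp add: powr_mult powr_powr)
  finally have "1 / (real p)\<^sup>2 \<le> 7000 powr (4 / 3) * ln (2 * real N) powr (- 4 / 3)"
    using p pos by (simp add: powr_minus_divide field_simps)
  then have "4 * real N * (1 / (real p)\<^sup>2)
      \<le> 4 * real N * (7000 powr (4 / 3) * ln (2 * real N) powr (- 4 / 3))"
    by (intro mult_left_mono) auto
  moreover have "2 * real p \<le> 8 * sqrt (real N)"
    using p(2) Q(2) by linarith
  moreover have "sqrt (real N) = real N powr (1 / 2)"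
    by (simp add: powr_half_sqrt)
  ultimately show ?thesis
    using alt_sin_partial_sum_via_fraction[OF pq(1) p(1) pq(4), of N] NQ
    by (simp add: algebra_simps)
qed

text \<open>
  The factor 2 inside the logarithm keeps it positive at \<open>n = 1\<close>, so the terms decrease from there
  on and Cauchy condensation turns the series into a \<open>p\<close>-series.
\<close>

lemma summable_inverse_mult_ln_powr:
  assumes "s > 1"
  shows "summable (\<lambda>n. ln (2 * real n) powr (- s) / real n)"
proof (subst condensation_test)
  fix m :: nat
  assume m: "0 < m"
  have "ln (2 * real (Suc m)) powr (- s) \<le> ln (2 * real m) powr (- s)"
    using m assms by (intro powr_mono2') auto
  then show "ln (2 * real (Suc m)) powr (- s) / real (Suc m) \<le> ln (2 * real m) powr (- s) / real m"
    using m by (intro frac_le) auto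
next
  have "2 ^ n * (ln (2 * real (2 ^ n)) powr (- s) / real (2 ^ n))
      = ln 2 powr (- s) * real (Suc n) powr (- s)" for n
  proof -
    have "ln (2 * real (2 ^ n)) = real (Suc n) * ln 2"
      using ln_realpow[of 2 "Suc n"] by simp
    then show ?thesis
      by (simp add: powr_mult mult.commute)
  qed
  moreover have "summable (\<lambda>n. real (Suc n) powr (- s))"
    using assms by (subst summable_Suc_iff) (simp add: summable_real_powr_iff)
  ultimately show "summable (\<lambda>n. 2 ^ n * (ln (2 * real (2 ^ n)) powr (- s) / real (2 ^ n)))"
    by (simp only: summable_mult)
qed simp_all

text \<open>
  Abel summation: with \<open>S\<close> the partial sums of \<open>f\<close>, the term \<open>f (n + 1) / (n + 1)\<close> is
  \<open>S (n + 2) * (1 / (n + 1) - 1 / (n + 2))\<close> plus a telescoping difference of \<open>S (n + 1) / (n + 1)\<close>.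
\<close>

lemma summable_over_index_from_partial_sums:
  fixes f B :: "nat \<Rightarrow> real"
  assumes bound: "\<And>N. N \<ge> 1 \<Longrightarrow> \<bar>\<Sum>n<N. f n\<bar> \<le> B N"
    and sum: "summable (\<lambda>N. B N / (real N)\<^sup>2)"
    and lim: "(\<lambda>N. B N / real N) \<longlonglongrightarrow> 0"
  shows "summable (\<lambda>n. f (Suc n) / real (Suc n))"
proof -
  define S where "S N = (\<Sum>n<N. f n)" for N
  define T where "T n = S (Suc n) / real (Suc n)" for n
  have B: "\<bar>S N\<bar> \<le> B N" if "N \<ge> 1" for N
    using bound[OF that] by (simp add: S_def)
  have "(\<lambda>N. S N / real N) \<longlonglongrightarrow> 0"
  proof (rule Lim_null_comparison[OF _ lim])
    show "\<forall>\<^sub>F N in sequentially. norm (S N / real N) \<le> B N / real N"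
      using eventually_ge_at_top[of 1] by eventually_elim (auto intro!: divide_right_mono B)
  qed
  then have "T \<longlonglongrightarrow> 0"
    unfolding T_def by (rule LIMSEQ_Suc)
  then have tele: "summable (\<lambda>n. T (Suc n) - T n)"
    by (rule telescope_summable)
  have main: "summable (\<lambda>n. S (n + 2) * (1 / real (n + 1) - 1 / real (n + 2)))"
  proof (rule summable_comparison_test')
    show "summable (\<lambda>n. 2 * (B (n + 2) / (real (n + 2))\<^sup>2))"
      by (intro summable_mult summable_ignore_initial_segment sum)
    fix n :: nat
    have "1 / real (n + 1) - 1 / real (n + 2) = 1 / (real (n + 1) * real (n + 2))"
      by (simp add: field_simps)
    also have "\<dots> \<le> 1 / (real (n + 2) / 2 * real (n + 2))"
      by (intro divide_left_mono mult_right_mono) auto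
    finally have le: "1 / real (n + 1) - 1 / real (n + 2) \<le> 2 / (real (n + 2))\<^sup>2"
      by (simp add: power2_eq_square)
    have "norm (S (n + 2) * (1 / real (n + 1) - 1 / real (n + 2)))
        = \<bar>S (n + 2)\<bar> * (1 / real (n + 1) - 1 / real (n + 2))"
      by (simp add: abs_mult field_simps)
    also have "\<dots> \<le> B (n + 2) * (2 / (real (n + 2))\<^sup>2)"
      using B[of "n + 2"] le by (intro mult_mono) (auto simp: field_simps)
    finally show "norm (S (n + 2) * (1 / real (n + 1) - 1 / real (n + 2)))
        \<le> 2 * (B (n + 2) / (real (n + 2))\<^sup>2)"
      by (simp only: mult.commute times_divide_eq_right)
  qed
  have "f (Suc n) / real (Suc n)
      = S (n + 2) * (1 / real (n + 1) - 1 / real (n + 2)) + (T (Suc n) - T n)" for n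
  proof -
    have "f (Suc n) = S (n + 2) - S (n + 1)"
      by (simp add: S_def)
    then show ?thesis
      by (simp add: T_def diff_divide_distrib right_diff_distrib add.commute)
  qed
  then show ?thesis
    using summable_add[OF main tele] by simp
qed

theorem corollary5:
  shows "summable (\<lambda>n::nat. (-1::real) ^ Suc n * \<bar>sin (real (Suc n))\<bar> / real (Suc n))"
proof -
  define A :: real where "A = 4 * 7000 powr (4 / 3)"
  define B where "B N = A * (real N * ln (2 * real N) powr (- 4 / 3)) + 10 * real N powr (1 / 2)" for N
  have "summable (\<lambda>n. alt_sin (Suc n) / real (Suc n))"
  proof (rule summable_over_index_from_partial_sums)
    show "\<bar>\<Sum>n<N. alt_sin n\<bar> \<le> B N" if "N \<ge> 1" for N
      using alt_sin_partial_sum_bound[OF that] by (simp add: A_def B_def)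
    have "B N / (real N)\<^sup>2 = A * (ln (2 * real N) powr (- (4 / 3)) / real N) + 10 * real N powr (- (3 / 2))" for N
    proof (cases "N = 0")
      case False
      have "real N powr (1 / 2) / (real N)\<^sup>2 = real N powr (1 / 2 - 2)"
        using False by (simp only: powr_diff) simp
      then show ?thesis
        using False by (simp add: B_def add_divide_distrib power2_eq_square)
    qed (simp add: B_def)
    moreover have "summable (\<lambda>N. A * (ln (2 * real N) powr (- (4 / 3)) / real N) + 10 * real N powr (- (3 / 2)))"
      by (intro summable_add summable_mult summable_inverse_mult_ln_powr)
        (simp_all add: summable_real_powr_iff)
    ultimately show "summable (\<lambda>N. B N / (real N)\<^sup>2)"
      by simp
    have lnlim: "filterlim (\<lambda>N. ln (2 * real N)) at_top sequentially"
      by (rule filterlim_compose[OF ln_at_top])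
        (intro filterlim_tendsto_pos_mult_at_top[OF tendsto_const] filterlim_real_sequentially, simp)
    have "(\<lambda>N. A * ln (2 * real N) powr (- (4 / 3)) + 10 * real N powr (- (1 / 2))) \<longlonglongrightarrow> A * 0 + 10 * 0"
      by (intro tendsto_intros tendsto_neg_powr lnlim filterlim_real_sequentially) auto
    moreover have "\<forall>\<^sub>F N in sequentially. A * ln (2 * real N) powr (- (4 / 3)) + 10 * real N powr (- (1 / 2)) = B N / real N"
      using eventually_ge_at_top[of 1]
    proof eventually_elim
      case (elim N)
      have "real N powr (1 / 2) / real N = real N powr (1 / 2 - 1)"
        using elim by (simp only: powr_diff) simp
      then show ?case
        using elim by (simp add: B_def add_divide_distrib)
    qed
    ultimately show "(\<lambda>N. B N / real N) \<longlonglongrightarrow> 0"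
      by (simp add: tendsto_cong)
  qed
  then show ?thesis
    by (simp only: alt_sin_def)
qed

end
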